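(* Let $n\geq 6$ be an integer. Then there exist four completely independent spanning trees in the augmented cube $AQ_n$, of which two have diameter $2n-3$ and two have diameter $2n-5$.
   Context: All graphs are finite and undirected. Augmented cube: for an integer $n\ge 1$, the $n$-dimensional augmented cube $AQ_n$ is a graph with $2^n$ vertices, labeled by the $n$-bit binary strings $u_1u_2\cdots u_n$. It is defined recursively. $AQ_1$ is the complete graph $K_2$ with vertex set $\{0,1\}$. For $n\ge 2$, $AQ_n$ is obtained from two copies of $AQ_{n-1}$, denoted $AQ_{n-1}^0$ with vertex set $\{0u_2\cdots u_n : u_i\in\{0,1\}\}$ and $AQ_{n-1}^1$ with vertex set $\{1v_2\cdots v_n : v_i\in\{0,1\}\}$ (the label of each vertex of $AQ_{n-1}$ being prefixed by $0$, respectively $1$), by adding $2^n$ edges between them: a vertex $0u_2\cdots u_n$ is joined to a vertex $1v_2\cdots v_n$ if and only if either $u_i=v_i$ for all $2\le i\le n$, or $u_i=\overline{v_i}$ for all $2\le i\le n$, where $\overline{v_i}=1-v_i$. Completely independent spanning trees: a spanning tree of a graph $G$ is a subgraph $T$ of $G$ that is a tree with $V(T)=V(G)$. For a tree $T$ and vertices $u,v$ of $T$, let $P_T(u,v)$ be the set of vertices of the unique path between $u$ and $v$ in $T$. Two spanning trees $T_1,T_2$ of $G$ are edge-disjoint if $E(T_1)\cap E(T_2)=\emptyset$, and internally vertex disjoint if $P_{T_1}(u,v)\cap P_{T_2}(u,v)=\{u,v\}$ for every pair of vertices $u,v$ of $G$. Spanning trees $T_1,\dots,T_k$ of $G$ are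 completely independent if they are pairwise edge-disjoint and pairwise internally vertex disjoint. The diameter of a tree is the maximum length (number of edges) of a path in it. *)

theory Defs
  imports "Graph_Theory.Graph_Theory"
begin

text \<open>
  As in Graph\_Theory, an undirected simple graph is a symmetric loop-free digraph
  (\<^locale>\<open>pair_graph\<close>): the edge \<open>{u, v}\<close> is the pair of arcs \<open>(u, v)\<close>, \<open>(v, u)\<close>.
\<close>

section \<open>Augmented cubes\<close>

text \<open>
  Bits are booleans and a binary string is the list of its bits, leftmost first, so that
  prefixing a bit is \<^const>\<open>Cons\<close> and complementing a string is \<open>map Not\<close>.  Only dimensions
  at least 1 are meaningful; dimension 0 is set to the one-vertex graph.
\<close>

fun augmented_cube :: "nat \<Rightarrow> bool list pair_pre_digraph" where
  "augmented_cube 0 = \<lparr> pverts = {[]}, parcs = {} \<rparr>"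
| "augmented_cube (Suc 0) =
    \<lparr> pverts = {[False], [True]}, parcs = {([False], [True]), ([True], [False])} \<rparr>"
| "augmented_cube (Suc (Suc n)) =
    (let G = augmented_cube (Suc n) in
     \<lparr> pverts = Cons False ` pverts G \<union> Cons True ` pverts G,
       parcs = {(b # u, b # v) | b u v. (u, v) \<in> parcs G}
             \<union> {(b # u, (\<not> b) # v) | b u v.
                  u \<in> pverts G \<and> v \<in> pverts G \<and> (u = v \<or> u = map Not v)} \<rparr>)"

lemma pverts_augmented_cube: "pverts (augmented_cube n) = {u. length u = n}"
proof (induction n rule: augmented_cube.induct)
  case 2
  show ?case by (auto simp: length_Suc_conv)
next
  case (3 n)
  then show ?case by (fastforce simp: Let_def length_Suc_conv image_iff)
qed simp

lemma card_pverts_augmented_cube: "card (pverts (augmented_cube n)) = 2 ^ n"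
  using card_lists_length_eq[of "UNIV :: bool set" n] by (simp add: pverts_augmented_cube)

lemma pair_graph_augmented_cube: "pair_graph (augmented_cube n)"
proof -
  have arcs: "e \<in> parcs (augmented_cube n) \<Longrightarrow>
      length (fst e) = n \<and> length (snd e) = n \<and> fst e \<noteq> snd e \<and>
      (snd e, fst e) \<in> parcs (augmented_cube n)" for e
  proof (induction n arbitrary: e rule: augmented_cube.induct)
    case (3 n)
    then show ?case
      by (fastforce simp: Let_def pverts_augmented_cube comp_def)
  qed auto
  have fin: "finite (pverts (augmented_cube n))"
    using finite_lists_length_eq[of "UNIV :: bool set" n] by (simp add: pverts_augmented_cube)
  moreover have "parcs (augmented_cube n) \<subseteq> pverts (augmented_cube n) \<times> pverts (augmented_cube n)"
    using arcs by (fastforce simp: pverts_augmented_cube)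
  ultimately have "finite (parcs (augmented_cube n))"
    by (meson finite_SigmaI finite_subset)
  moreover have "symmetric (augmented_cube n)"
    unfolding symmetric_def sym_def using arcs by (force simp: arcs_ends_def arc_to_ends_def)
  ultimately show ?thesis
    using arcs fin by unfold_locales (auto simp: pverts_augmented_cube)
qed

section \<open>Completely independent spanning trees\<close>

text \<open>
  The constants \<^const>\<open>forest\<close>, \<^const>\<open>tree\<close> and \<^const>\<open>spanning_tree\<close> of Graph\_Theory forbid all
  directed cycles, so they never hold for a symmetric digraph with an arc, where \<open>u, v, u\<close> is
  a cycle.  In a symmetric simple digraph the cycles of the underlying undirected graph are
  those with at least three arcs.
\<close>

definition undirected_tree :: "'a pair_pre_digraph \<Rightarrow> bool" where
  "undirected_tree T \<longleftrightarrow> pair_graph T \<and> Digraph_Component.connected (with_proj T) \<and>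
     \<not> (\<exists>p. pre_digraph.cycle (with_proj T) p \<and> 3 \<le> length p)"

definition undirected_spanning_tree :: "'a pair_pre_digraph \<Rightarrow> 'a pair_pre_digraph \<Rightarrow> bool" where
  "undirected_spanning_tree T G \<longleftrightarrow> undirected_tree T \<and> spanning (with_proj T) (with_proj G)"

definition tree_path_verts :: "'a pair_pre_digraph \<Rightarrow> 'a \<Rightarrow> 'a \<Rightarrow> 'a set" where
  "tree_path_verts T u v =
     set (pre_digraph.awalk_verts (with_proj T) u (THE p. pre_digraph.apath (with_proj T) u p v))"

definition edge_disjoint :: "'a pair_pre_digraph \<Rightarrow> 'a pair_pre_digraph \<Rightarrow> bool" where
  "edge_disjoint T1 T2 \<longleftrightarrow> parcs T1 \<inter> parcs T2 = {}"

definition internally_vertex_disjoint ::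
  "'a pair_pre_digraph \<Rightarrow> 'a pair_pre_digraph \<Rightarrow> 'a pair_pre_digraph \<Rightarrow> bool" where
  "internally_vertex_disjoint G T1 T2 \<longleftrightarrow>
     (\<forall>u \<in> pverts G. \<forall>v \<in> pverts G. tree_path_verts T1 u v \<inter> tree_path_verts T2 u v = {u, v})"

definition completely_independent_spanning_trees ::
  "'a pair_pre_digraph \<Rightarrow> 'a pair_pre_digraph list \<Rightarrow> bool" where
  "completely_independent_spanning_trees G Ts \<longleftrightarrow>
     (\<forall>T \<in> set Ts. undirected_spanning_tree T G) \<and>
     (\<forall>i < length Ts. \<forall>j < length Ts. i \<noteq> j \<longrightarrow>
        edge_disjoint (Ts ! i) (Ts ! j) \<and> internally_vertex_disjoint G (Ts ! i) (Ts ! j))"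

definition tree_diameter :: "'a pair_pre_digraph \<Rightarrow> nat" where
  "tree_diameter T = Max {length p | u p v. pre_digraph.apath (with_proj T) u p v}"

end

theory Submission
  imports Defs
begin

text \<open>
  A rooted tree is handled through its parent function and the depths of its vertices.  In such a
  tree a path first climbs and then descends, so paths are unique (\<open>apath_unique\<close>), their
  lengths are controlled by depths, and every interior vertex of a path is the parent of some
  vertex (\<open>path_inner_verts\<close>).  Hence spanning trees are completely independent as soon as
  no edge is used twice and no vertex is a parent in two of the trees
  (\<open>trees_completely_independent\<close>).

  Such a family on \<open>AQ\<^sub>n\<close> yields one on \<open>AQ\<^sub>n\<^sub>+\<^sub>1\<close>: put every tree into both copies of
  \<open>AQ\<^sub>n\<close> and join its two copies by the edge between the two copies of its root.  The roots
  are interior vertices of their trees, hence distinct, and no vertex changes from a leaf of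
  one tree to an interior vertex of it (\<open>independent_rooted_trees_double\<close>).  If the tree
  had height \<open>R\<close>, the new one is symmetric about the joining edge, so its diameter is
  \<open>2 R + 1\<close> whatever the diameter of the old one was (\<open>tree_diameter_double\<close>); and its
  height is \<open>R + 1\<close>, so that the diameter grows by 2 with every further step.

  It remains to find four such trees on \<open>AQ\<^sub>5\<close> with heights 4, 4, 3, 3: the next step gives
  the diameters \<open>9 = 2 \<sqdot> 6 - 3\<close> and \<open>7 = 2 \<sqdot> 6 - 5\<close> on \<open>AQ\<^sub>6\<close>.  Since \<open>AQ\<^sub>5\<close> is a
  Cayley graph of the group of binary words of length 5, one tree suffices whose set of interior
  vertices is a transversal of a subgroup of order 4 and whose translates by that subgroup
  share no edge.  Its height depends on the choice of the root, which is chosen at a centre for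
  two of the translates and next to that centre for the other two.
\<close>

section \<open>Trees given by a parent function\<close>

definition tree_graph :: "'a set \<Rightarrow> 'a \<Rightarrow> ('a \<Rightarrow> 'a) \<Rightarrow> 'a pair_pre_digraph" where
  "tree_graph V r parent =
     \<lparr> pverts = V,
       parcs = {(v, parent v) | v. v \<in> V - {r}} \<union> {(parent v, v) | v. v \<in> V - {r}} \<rparr>"

locale rooted_tree =
  fixes V :: "'a set" and root :: 'a and parent :: "'a \<Rightarrow> 'a" and depth :: "'a \<Rightarrow> nat"
  assumes finite_V: "finite V"
    and root_in_V: "root \<in> V"
    and depth_root: "depth root = 0"
    and parent_in_V: "\<lbrakk>v \<in> V; v \<noteq> root\<rbrakk> \<Longrightarrow> parent v \<in> V"
    and depth_parent: "\<lbrakk>v \<in> V; v \<noteq> root\<rbrakk> \<Longrightarrow> depth v = Suc (depth (parent v))"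
begin

abbreviation "T \<equiv> tree_graph V root parent"

lemma pverts_T [simp]: "pverts T = V"
  by (simp add: tree_graph_def)

lemma arc_T_iff:
  "(u, v) \<in> parcs T \<longleftrightarrow>
     u \<in> V \<and> u \<noteq> root \<and> v = parent u \<or> v \<in> V \<and> v \<noteq> root \<and> u = parent v"
  by (auto simp: tree_graph_def)

lemma pair_graph_T: "pair_graph T"
proof
  fix e assume e: "e \<in> parcs T"
  obtain u v where [simp]: "e = (u, v)" by (cases e)
  show "fst e \<in> pverts T" "snd e \<in> pverts T"
    using e parent_in_V by (auto simp: arc_T_iff)
  show "fst e \<noteq> snd e"
    using e depth_parent by (fastforce simp: arc_T_iff)
next
  have "parcs T = (\<lambda>v. (v, parent v)) ` (V - {root}) \<union> (\<lambda>v. (parent v, v)) ` (V - {root})"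
    by (auto simp: tree_graph_def)
  then show "finite (parcs T)"
    by (simp add: finite_V)
qed (auto simp: finite_V symmetric_def sym_def arc_T_iff)

sublocale T: pair_graph "tree_graph V root parent"
  by (rule pair_graph_T)

text \<open>
  A path cannot step back to the vertex that it has just left, and the parent is the only
  neighbour of smaller depth; so a path that starts downwards keeps descending.
\<close>
lemma descending_path_stays_below:
  assumes "T.apath u ((u, w) # q) v" "w \<noteq> root" "parent w = u"
  shows "depth u < depth v"
  using assms
proof (induction q arbitrary: u w)
  case Nil
  then show ?case
    using depth_parent[of v] by (auto simp: T.apath_simps)
next
  case (Cons e q)
  obtain x where e: "e = (w, x)"
    using Cons.prems(1) by (cases e) (auto simp: T.apath_simps)
  have path: "T.apath w ((w, x) # q) v" and avoids: "u \<notin> set (pawalk_verts x q)"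
    using Cons.prems(1) unfolding e T.apath_Cons_iff[of u "(u, w)"] by simp_all
  then have arc: "(w, x) \<in> parcs T" and walk: "T.awalk x q v"
    by (simp_all add: T.apath_def T.awalk_Cons_iff)
  have w: "w \<in> V" and "x \<noteq> u"
    using T.in_arcsD1[OF arc] T.hd_in_awalk_verts(1)[OF walk] avoids by auto
  have "x \<noteq> root \<and> parent x = w"
    using arc \<open>x \<noteq> u\<close> Cons.prems(2,3) by (auto simp: arc_T_iff)
  then have "depth w < depth v"
    using Cons.IH path by blast
  then show ?case
    using depth_parent[of w] w Cons.prems by simp
qed

text \<open>
  This is the recursion for paths used below: unless a path is trivial, its deeper end is left
  towards the root.
\<close>
lemma path_first_step_up:
  assumes "T.apath u p v" "u \<noteq> v" "depth v \<le> depth u"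
  obtains q where "p = (u, parent u) # q" "u \<noteq> root" "u \<in> V"
    "T.apath (parent u) q v" "u \<notin> set (pawalk_verts (parent u) q)"
proof -
  obtain w q where p: "p = (u, w) # q"
    using assms(1,2) by (cases p) (auto simp: T.apath_simps)
  then have path: "T.apath w q v" "u \<notin> set (pawalk_verts w q)" and arc: "(u, w) \<in> parcs T"
    using assms(1) by (auto simp: T.apath_Cons_iff)
  have "\<not> (w \<noteq> root \<and> parent w = u)"
    using descending_path_stays_below[of u w q v] assms(1,3) p by auto
  then have "w = parent u" "u \<noteq> root" "u \<in> V"
    using arc unfolding arc_T_iff by blast+
  then show thesis
    using that[of q] p path by simp
qed

text \<open>
  Shortening a path at its deeper end reduces the sum of the depths of its ends.  By reversing
  paths, only the case where the first end is the deeper one has to be treated.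
\<close>
lemma apath_induct [consumes 1, case_names Nil up rev]:
  assumes path: "T.apath u p v"
    and Nil: "\<And>u. u \<in> V \<Longrightarrow> P u [] u"
    and up: "\<And>u q v. \<lbrakk>u \<in> V; u \<noteq> root; u \<noteq> v; depth v \<le> depth u;
               T.apath (parent u) q v; P (parent u) q v\<rbrakk> \<Longrightarrow> P u ((u, parent u) # q) v"
    and rev: "\<And>u p v. \<lbrakk>T.apath u p v; P u p v\<rbrakk> \<Longrightarrow> P v (rev_path p) u"
  shows "P u p v"
  using path
proof (induction "depth u + depth v" arbitrary: u p v rule: less_induct)
  case less
  have main: "P x p y" if path: "T.apath x p y" and le: "depth y \<le> depth x"
    and sum: "depth x + depth y = depth u + depth v" for x p y
  proof (cases "x = y")
    case True
    then have "p = []" using path T.apath_nonempty_ends[of x p y] by auto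
    then show ?thesis using path True Nil[of y] by (simp add: T.apath_Nil_iff)
  next
    case False
    obtain q where q: "p = (x, parent x) # q" "x \<noteq> root" "x \<in> V" "T.apath (parent x) q y"
      by (rule path_first_step_up[OF path False le])
    have "P (parent x) q y"
      using less.hyps[of "parent x" y q] depth_parent[of x] sum q by simp
    then show ?thesis
      unfolding q(1) by (rule up[OF q(3,2) False le q(4)])
  qed
  show ?case
  proof (cases "depth v \<le> depth u")
    case True
    then show ?thesis using main[OF less.prems] by blast
  next
    case False
    have path: "T.apath v (rev_path p) u"
      using less.prems by simp
    then have "P v (rev_path p) u"
      by (rule main) (use False in auto)
    then show ?thesis
      using rev[OF path] by simp
  qed
qed

lemma apath_unique:
  assumes "T.apath u p v" "T.apath u p' v"
  shows "p' = p"
  using assms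
proof (induction arbitrary: p' rule: apath_induct)
  case (Nil u)
  then show ?case using T.apath_nonempty_ends[of u p' u] by auto
next
  case (up u q v)
  obtain q' where "p' = (u, parent u) # q'" "T.apath (parent u) q' v"
    by (rule path_first_step_up[OF \<open>T.apath u p' v\<close> \<open>u \<noteq> v\<close> \<open>depth v \<le> depth u\<close>])
  then show ?case
    using up.IH[of q'] by simp
next
  case (rev u p v)
  have "rev_path p' = p"
    by (rule rev.IH) (use rev.prems in simp)
  then show ?case
    by auto
qed

lemma reachable_root: "v \<in> V \<Longrightarrow> v \<rightarrow>\<^sup>*\<^bsub>with_proj T\<^esub> root"
proof (induction "depth v" arbitrary: v rule: less_induct)
  case less
  show ?case
  proof (cases "v = root")
    case True
    then show ?thesis using less.prems by simp
  next
    case False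
    have "(v, parent v) \<in> parcs T"
      using less.prems False by (simp add: arc_T_iff)
    moreover have "parent v \<rightarrow>\<^sup>*\<^bsub>with_proj T\<^esub> root"
      using less.hyps[of "parent v"] less.prems False parent_in_V[of v] depth_parent[of v]
      by simp
    ultimately show ?thesis
      by (rule T.adj_reachable_trans)
  qed
qed

lemma reachable_T:
  assumes "u \<in> V" "v \<in> V"
  shows "u \<rightarrow>\<^sup>*\<^bsub>with_proj T\<^esub> v"
  using reachable_root[OF assms(1)] T.symmetric_reachable'[OF reachable_root[OF assms(2)]]
  by (rule T.reachable_trans)

lemma apath_exists:
  assumes "u \<in> V" "v \<in> V"
  obtains p where "T.apath u p v"
proof -
  have "\<exists>p. T.apath u p v"
    by (rule T.reachable_apath[THEN iffD1, OF reachable_T[OF assms]])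
  then show thesis
    by (elim exE that)
qed

text \<open>
  A cycle with at least three arcs would provide two paths between adjacent vertices: a single
  arc, and the rest of the cycle.
\<close>
lemma undirected_tree_T: "undirected_tree T"
  unfolding undirected_tree_def
proof (intro conjI notI)
  show "pair_graph T" by (rule pair_graph_T)
  show "Digraph_Component.connected (with_proj T)"
    unfolding Digraph_Component.connected_def
  proof (rule strongly_connectedI)
    show "verts (with_proj (mk_symmetric (with_proj T))) \<noteq> {}"
      using root_in_V by (simp add: mk_symmetric_def) blast
    fix u v assume "u \<in> verts (with_proj (mk_symmetric (with_proj T)))"
      and "v \<in> verts (with_proj (mk_symmetric (with_proj T)))"
    then have "u \<in> V" "v \<in> V"
      by (simp_all add: mk_symmetric_def)
    then show "u \<rightarrow>\<^sup>*\<^bsub>with_proj (mk_symmetric (with_proj T))\<^esub> v"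
      by (rule T.reachable_mk_symmetricI[OF reachable_T])
  qed
  assume "\<exists>p. T.cycle p \<and> 3 \<le> length p"
  then obtain p u where p: "T.awalk u p u" "distinct (tl (pawalk_verts u p))" "3 \<le> length p"
    unfolding T.cycle_def by auto
  obtain w q where pq: "p = (u, w) # q"
    using p by (cases p) (auto simp: T.awalk_Cons_iff)
  have arc: "(u, w) \<in> parcs T" and q: "T.apath w q u"
    using p by (auto simp: pq T.awalk_Cons_iff T.apath_def)
  have "T.apath w [(w, u)] u"
    using T.arcs_symmetric[OF arc] T.no_loops'[OF arc] T.in_arcsD1[OF arc]
    by (simp add: T.apath_simps)
  then have "q = [(w, u)]"
    by (rule apath_unique[OF _ q])
  then show False
    using p(3) pq by simp
qed

lemma path_inner_verts:
  assumes "T.apath u p v"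
  shows "set (pawalk_verts u p) \<subseteq> {u, v} \<union> parent ` (V - {root})"
  using assms
proof (induction rule: apath_induct)
  case (rev u p v)
  then show ?case
    by (auto simp: T.awalk_verts_rev_path T.apath_def)
qed auto

lemma tree_path_verts_T:
  assumes "u \<in> V" "v \<in> V"
  shows "{u, v} \<subseteq> tree_path_verts T u v"
    and "tree_path_verts T u v \<subseteq> {u, v} \<union> parent ` (V - {root})"
proof -
  obtain p where p: "T.apath u p v"
    using apath_exists[OF assms] .
  have "(THE p. T.apath u p v) = p"
    by (rule the_equality, rule p, rule apath_unique[OF p])
  then have eq: "tree_path_verts T u v = set (pawalk_verts u p)"
    by (simp add: tree_path_verts_def)
  show "tree_path_verts T u v \<subseteq> {u, v} \<union> parent ` (V - {root})"
    using path_inner_verts[OF p] eq by simp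
  show "{u, v} \<subseteq> tree_path_verts T u v"
    using p T.hd_in_awalk_verts(1)[of u p v] T.awlast_of_awalk[of u p v]
    by (auto simp: eq T.apath_def)
qed

lemma subtree_depth_le:
  assumes "S \<subseteq> V" "\<And>v. \<lbrakk>v \<in> S; v \<noteq> c\<rbrakk> \<Longrightarrow> v \<noteq> root \<and> parent v \<in> S" "v \<in> S"
  shows "v = c \<or> depth c < depth v"
  using assms(3)
proof (induction "depth v" arbitrary: v rule: less_induct)
  case less
  show ?case
  proof (cases "v = c")
    case False
    then have "v \<noteq> root" "parent v \<in> S" "v \<in> V"
      using assms(1) assms(2)[of v] less.prems by auto
    then show ?thesis
      using depth_parent[of v] less.hyps[of "parent v"] by auto
  qed simp
qed

text \<open>
  The premises make \<open>S\<close> a subtree with root \<open>c\<close>.  A path between two of its vertices climbs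
  at most to \<open>c\<close>, so both of its parts are shorter than the way to the root by the depth of \<open>c\<close>.
\<close>
lemma subtree_path_length:
  assumes S: "S \<subseteq> V" "\<And>v. \<lbrakk>v \<in> S; v \<noteq> c\<rbrakk> \<Longrightarrow> v \<noteq> root \<and> parent v \<in> S"
    and path: "T.apath u p v" and "u \<in> S" "v \<in> S"
  shows "length p + 2 * depth c \<le> depth u + depth v"
proof -
  have below: "v = c \<or> depth c < depth v" if "v \<in> S" for v
    by (rule subtree_depth_le[of S]) (use S that in auto)
  show ?thesis
    using path \<open>u \<in> S\<close> \<open>v \<in> S\<close>
  proof (induction rule: apath_induct)
    case (Nil u)
    then show ?case
      using below[of u] by force
  next
    case (up u q v)
    have "u \<noteq> c"
      using below[of v] up by auto
    then show ?case
      using S(2)[of u] up depth_parent[of u] by auto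
  next
    case (rev u p v)
    have "length (rev_path p) = length p"
      by (induction p) auto
    then show ?case
      using rev by simp
  qed
qed

text \<open>
  With a suitable potential \<open>f\<close> this shows that the path between two vertices is long, without
  describing its course.
\<close>
lemma awalk_length_ge:
  fixes f :: "'a \<Rightarrow> int"
  assumes "T.awalk u p v" "\<And>w. \<lbrakk>w \<in> V; w \<noteq> root\<rbrakk> \<Longrightarrow> \<bar>f w - f (parent w)\<bar> \<le> 1"
  shows "f u - f v \<le> length p"
  using assms(1)
proof (induction p arbitrary: u)
  case (Cons e p)
  then obtain w where "(u, w) \<in> parcs T" "T.awalk w p v"
    by (cases e) (auto simp: T.awalk_Cons_iff)
  moreover from this have "\<bar>f u - f w\<bar> \<le> 1"
    using assms(2)[of u] assms(2)[of w] by (auto simp: arc_T_iff)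
  ultimately show ?case
    using Cons.IH[of w] by simp
qed (auto simp: T.awalk_Nil_iff)

text \<open>
  Cutting the edge between the root and its child \<open>c\<close> leaves two trees of equal height \<open>R\<close>,
  one with root \<open>c\<close> and vertex set \<open>S\<close>, the other with the old root.  A longest path joins two deepest
  vertices, one on each side, through that edge.
\<close>
lemma tree_diameter_central_edge:
  assumes c: "c \<in> S" "S \<subseteq> V" "c \<noteq> root" "parent c = root" "root \<notin> S"
    and S: "\<And>v. \<lbrakk>v \<in> V; v \<noteq> root; v \<noteq> c\<rbrakk> \<Longrightarrow> parent v \<in> S \<longleftrightarrow> v \<in> S"
    and le: "\<And>v. v \<in> S \<Longrightarrow> depth v \<le> Suc R" "\<And>v. v \<in> V - S \<Longrightarrow> depth v \<le> R"
    and a: "a \<in> S" "depth a = Suc R" and b: "b \<in> V - S" "depth b = R"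
  shows "tree_diameter T = 2 * R + 1"
  unfolding tree_diameter_def
proof (rule Max_eqI)
  let ?L = "{length p |u p v. T.apath u p v}"
  have bound: "length p \<le> 2 * R + 1" if p: "T.apath u p v" for u p v
  proof -
    have V: "u \<in> V" "v \<in> V"
      using p by (auto simp: T.apath_def dest: T.awalk_hd_in_verts T.awalk_last_in_verts)
    show ?thesis
    proof (cases "u \<in> S \<and> v \<in> S")
      case True
      have in_S: "x \<noteq> root \<and> parent x \<in> S" if "x \<in> S" "x \<noteq> c" for x
        using that c(2,5) S[of x] by auto
      have "depth c = 1"
        using c depth_parent[of c] depth_root by auto
      moreover have "length p + 2 * depth c \<le> depth u + depth v"
        by (rule subtree_path_length[OF c(2) in_S p]) (use True in simp_all)
      ultimately show ?thesis
        using True le(1)[of u] le(1)[of v] by simp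
    next
      case False
      have "length p \<le> depth u + depth v"
        using subtree_path_length[OF subset_refl _ p V, of root] parent_in_V by simp
      also have "\<dots> \<le> 2 * R + 1"
        using False V le(1)[of u] le(1)[of v] le(2)[of u] le(2)[of v]
        by (cases "u \<in> S"; cases "v \<in> S") auto
      finally show ?thesis .
    qed
  qed
  show le_bound: "y \<le> 2 * R + 1" if y: "y \<in> ?L" for y
  proof -
    obtain u p v where "y = length p" "T.apath u p v"
      using y by (elim CollectE exE conjE)
    then show ?thesis
      using bound by simp
  qed
  show "finite ?L"
    by (rule finite_subset[OF _ finite_atMost]) (rule subsetI, rule atMost_iff[THEN iffD2], rule le_bound)
  obtain p where p: "T.apath a p b"
    using apath_exists[of a b] a(1) b(1) c(2) by blast
  \<comment> \<open>Depth with a sign that tells the two sides of the central edge apart: it varies by 1 along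
    every edge, also along the central one, where it passes from 1 to 0.\<close>
  let ?f = "\<lambda>v. if v \<in> S then int (depth v) else - int (depth v)"
  have "\<bar>?f w - ?f (parent w)\<bar> \<le> 1" if "w \<in> V" "w \<noteq> root" for w
    using that S[of w] c depth_root depth_parent[of w] by (cases "w = c") auto
  then have "?f a - ?f b \<le> length p"
    using awalk_length_ge[of a p b ?f] p by (auto simp: T.apath_def)
  then have "2 * R + 1 = length p"
    using a b bound[OF p] by simp
  then show "2 * R + 1 \<in> ?L"
    using p by (intro CollectI exI conjI)
qed

end

section \<open>Families of independent trees in an augmented cube\<close>

text \<open>
  The set \<open>inner i\<close> contains all interior vertices of the tree \<open>i\<close>.  An edge common to two
  trees joins a vertex to its parent in both of them.  It cannot be the same
  vertex in both, as its two parents lie in disjoint sets; \<open>no_shared_edge\<close> excludes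
  the remaining case, in which either end is the parent of the other one.
\<close>
locale independent_rooted_trees =
  fixes n :: nat and K :: "'i set" and root :: "'i \<Rightarrow> bool list"
    and parent :: "'i \<Rightarrow> bool list \<Rightarrow> bool list" and depth :: "'i \<Rightarrow> bool list \<Rightarrow> nat"
    and inner :: "'i \<Rightarrow> bool list set"
  assumes rooted: "i \<in> K \<Longrightarrow> rooted_tree {v. length v = n} (root i) (parent i) (depth i)"
    and parent_arc: "\<lbrakk>i \<in> K; length v = n; v \<noteq> root i\<rbrakk> \<Longrightarrow>
          (v, parent i v) \<in> parcs (augmented_cube n)"
    and root_inner: "i \<in> K \<Longrightarrow> root i \<in> inner i"
    and parent_inner: "\<lbrakk>i \<in> K; length v = n; v \<noteq> root i\<rbrakk> \<Longrightarrow> parent i v \<in> inner i"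
    and inner_disjoint: "\<lbrakk>i \<in> K; j \<in> K; i \<noteq> j\<rbrakk> \<Longrightarrow> inner i \<inter> inner j = {}"
    and no_shared_edge: "\<lbrakk>i \<in> K; j \<in> K; i \<noteq> j; length v = n; v \<noteq> root j; parent j v \<noteq> root i\<rbrakk> \<Longrightarrow>
          parent i (parent j v) \<noteq> v"
begin

abbreviation tree :: "'i \<Rightarrow> bool list pair_pre_digraph" where
  "tree i \<equiv> tree_graph {v. length v = n} (root i) (parent i)"

lemma spanning_tree:
  assumes "i \<in> K"
  shows "undirected_spanning_tree (tree i) (augmented_cube n)"
proof -
  interpret R: rooted_tree "{v. length v = n}" "root i" "parent i" "depth i"
    by (rule rooted[OF assms])
  interpret G: pair_graph "augmented_cube n"
    by (rule pair_graph_augmented_cube)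
  have "(u, v) \<in> parcs (augmented_cube n)" if "(u, v) \<in> parcs (tree i)" for u v
    using that parent_arc[OF assms] G.arcs_symmetric by (auto simp: R.arc_T_iff)
  then have "parcs (tree i) \<subseteq> parcs (augmented_cube n)"
    by auto
  moreover have "wf_digraph (with_proj (tree i))" "wf_digraph (with_proj (augmented_cube n))"
    by unfold_locales
  ultimately have "spanning (with_proj (tree i)) (with_proj (augmented_cube n))"
    by (simp add: spanning_def subgraph_def compatible_def pverts_augmented_cube)
  then show ?thesis
    by (simp add: undirected_spanning_tree_def R.undirected_tree_T)
qed

lemma trees_edge_disjoint:
  assumes ij: "i \<in> K" "j \<in> K" "i \<noteq> j"
  shows "edge_disjoint (tree i) (tree j)"
proof -
  interpret Ri: rooted_tree "{v. length v = n}" "root i" "parent i" "depth i"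
    by (rule rooted[OF ij(1)])
  interpret Rj: rooted_tree "{v. length v = n}" "root j" "parent j" "depth j"
    by (rule rooted[OF ij(2)])
  have same: False if "length v = n" "v \<noteq> root i" "v \<noteq> root j" "parent i v = parent j v" for v
    using that parent_inner[OF ij(1), of v] parent_inner[OF ij(2), of v] inner_disjoint[OF ij]
    by auto
  have "False" if "(u, v) \<in> parcs (tree i)" "(u, v) \<in> parcs (tree j)" for u v
    using that unfolding Ri.arc_T_iff Rj.arc_T_iff mem_Collect_eq
  proof (elim disjE conjE)
    assume "length u = n" "u \<noteq> root i" "u \<noteq> root j" "v = parent i u" "v = parent j u"
    then show False
      using same[of u] by simp
  next
    assume "length v = n" "v \<noteq> root j" "u \<noteq> root i" "v = parent i u" "u = parent j v"
    then show False
      using no_shared_edge[OF ij, of v] by metis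
  next
    assume "length u = n" "u \<noteq> root j" "v \<noteq> root i" "u = parent i v" "v = parent j u"
    then show False
      using no_shared_edge[OF ij, of u] by metis
  next
    assume "length v = n" "v \<noteq> root i" "v \<noteq> root j" "u = parent i v" "u = parent j v"
    then show False
      using same[of v] by simp
  qed
  then show ?thesis
    by (auto simp: edge_disjoint_def)
qed

text \<open>
  Apart from \<open>u\<close> and \<open>v\<close>, the two paths between them consist of vertices that are parents in
  the respective tree, and such vertices are never shared.
\<close>
lemma trees_internally_vertex_disjoint:
  assumes ij: "i \<in> K" "j \<in> K" "i \<noteq> j"
  shows "internally_vertex_disjoint (augmented_cube n) (tree i) (tree j)"
  unfolding internally_vertex_disjoint_def
proof (intro ballI)
  interpret Ri: rooted_tree "{v. length v = n}" "root i" "parent i" "depth i"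
    by (rule rooted[OF ij(1)])
  interpret Rj: rooted_tree "{v. length v = n}" "root j" "parent j" "depth j"
    by (rule rooted[OF ij(2)])
  fix u v assume "u \<in> pverts (augmented_cube n)" "v \<in> pverts (augmented_cube n)"
  then have uv: "u \<in> {v. length v = n}" "v \<in> {v. length v = n}"
    by (simp_all add: pverts_augmented_cube)
  have "parent i ` ({v. length v = n} - {root i}) \<subseteq> inner i"
    by (rule image_subsetI) (simp add: parent_inner[OF ij(1)])
  from Un_mono[OF subset_refl this]
  have i: "tree_path_verts (tree i) u v \<subseteq> {u, v} \<union> inner i"
    by (rule subset_trans[OF Ri.tree_path_verts_T(2)[OF uv]])
  have "parent j ` ({v. length v = n} - {root j}) \<subseteq> inner j"
    by (rule image_subsetI) (simp add: parent_inner[OF ij(2)])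
  from Un_mono[OF subset_refl this]
  have j: "tree_path_verts (tree j) u v \<subseteq> {u, v} \<union> inner j"
    by (rule subset_trans[OF Rj.tree_path_verts_T(2)[OF uv]])
  show "tree_path_verts (tree i) u v \<inter> tree_path_verts (tree j) u v = {u, v}"
  proof
    have "tree_path_verts (tree i) u v \<inter> tree_path_verts (tree j) u v
        \<subseteq> ({u, v} \<union> inner i) \<inter> ({u, v} \<union> inner j)"
      using i j by (rule Int_mono)
    also have "\<dots> \<subseteq> {u, v}"
      using inner_disjoint[OF ij] by auto
    finally show "tree_path_verts (tree i) u v \<inter> tree_path_verts (tree j) u v \<subseteq> {u, v}" .
    show "{u, v} \<subseteq> tree_path_verts (tree i) u v \<inter> tree_path_verts (tree j) u v"
      using Ri.tree_path_verts_T(1)[OF uv] Rj.tree_path_verts_T(1)[OF uv] by simp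
  qed
qed

lemma trees_completely_independent:
  assumes "distinct is" "set is \<subseteq> K"
  shows "completely_independent_spanning_trees (augmented_cube n) (map tree is)"
  unfolding completely_independent_spanning_trees_def
proof (intro conjI ballI allI impI)
  show "undirected_spanning_tree T (augmented_cube n)" if T: "T \<in> set (map tree is)" for T
  proof -
    obtain i where "T = tree i" "i \<in> set is"
      using T by auto
    then show ?thesis
      using spanning_tree[of i] assms(2) by auto
  qed
  fix a b assume "a < length (map tree is)" "b < length (map tree is)" and ne: "a \<noteq> b"
  then have ab: "a < length is" "b < length is"
    by simp_all
  have ij: "is ! a \<in> K" "is ! b \<in> K" "is ! a \<noteq> is ! b"
    using subsetD[OF assms(2) nth_mem[OF ab(1)]] subsetD[OF assms(2) nth_mem[OF ab(2)]]
      nth_eq_iff_index_eq[OF assms(1) ab] ne by simp_all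
  show "edge_disjoint (map tree is ! a) (map tree is ! b)"
    unfolding nth_map[OF ab(1)] nth_map[OF ab(2)] by (rule trees_edge_disjoint[OF ij])
  show "internally_vertex_disjoint (augmented_cube n) (map tree is ! a) (map tree is ! b)"
    unfolding nth_map[OF ab(1)] nth_map[OF ab(2)]
    by (rule trees_internally_vertex_disjoint[OF ij])
qed

end

section \<open>Joining two copies of a family\<close>

text \<open>
  The tree on words of length \<open>n + 1\<close> made from two copies of a tree on words of length \<open>n\<close>
  with root \<open>r\<close>: the root of the copy with first bit 1 becomes a child of the root of the other copy.
\<close>
fun double_parent :: "bool list \<Rightarrow> (bool list \<Rightarrow> bool list) \<Rightarrow> bool list \<Rightarrow> bool list" where
  "double_parent r parent (b # v) = (if b \<and> v = r then False # r else b # parent v)"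
| "double_parent r parent [] = []"

fun double_depth :: "(bool list \<Rightarrow> nat) \<Rightarrow> bool list \<Rightarrow> nat" where
  "double_depth depth (b # v) = of_bool b + depth v"
| "double_depth depth [] = 0"

definition has_height :: "nat \<Rightarrow> (bool list \<Rightarrow> nat) \<Rightarrow> nat \<Rightarrow> bool" where
  "has_height n depth h \<longleftrightarrow>
     (\<forall>v. length v = n \<longrightarrow> depth v \<le> h) \<and> (\<exists>v. length v = n \<and> depth v = h)"

lemma has_height_double:
  assumes "has_height n depth h"
  shows "has_height (Suc n) (double_depth depth) (Suc h)"
proof -
  obtain v where v: "length v = n" "depth v = h"
    using assms by (auto simp: has_height_def)
  have "double_depth depth w \<le> Suc h" if len: "length w = Suc n" for w
  proof -
    obtain b x where w: "w = b # x" and "length x = n"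
      using len by (cases w) auto
    then have "depth x \<le> h"
      using assms by (simp add: has_height_def)
    then show ?thesis
      by (simp add: w of_bool_def)
  qed
  moreover have "length (True # v) = Suc n" "double_depth depth (True # v) = Suc h"
    using v by simp_all
  ultimately show ?thesis
    unfolding has_height_def by (intro conjI allI impI exI)
qed

lemma rooted_tree_double:
  assumes "rooted_tree {v. length v = n} r parent depth"
  shows "rooted_tree {v. length v = Suc n} (False # r) (double_parent r parent) (double_depth depth)"
proof -
  interpret rooted_tree "{v. length v = n}" r parent depth by fact
  show ?thesis
  proof
    show "finite {v :: bool list. length v = Suc n}"
      using finite_lists_length_eq[of "UNIV :: bool set" "Suc n"] by simp
    fix v :: "bool list" assume "v \<in> {v. length v = Suc n}" "v \<noteq> False # r"
    then show "double_parent r parent v \<in> {v. length v = Suc n}"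
      "double_depth depth v = Suc (double_depth depth (double_parent r parent v))"
      using root_in_V depth_root parent_in_V[of "tl v"] depth_parent[of "tl v"]
      by (cases v; auto)+
  qed (use root_in_V depth_root in auto)
qed

text \<open>
  Both copies have height \<open>R\<close> above their ends of the joining edge, so the distance of two deepest
  vertices in different copies is \<open>R + 1 + R\<close>.
\<close>
lemma tree_diameter_double:
  assumes tree: "rooted_tree {v. length v = n} r parent depth"
    and height: "has_height n depth R"
  shows "tree_diameter (tree_graph {v. length v = Suc n} (False # r) (double_parent r parent))
    = 2 * R + 1"
proof -
  have le: "depth v \<le> R" if "length v = n" for v
    using height that by (simp add: has_height_def)
  obtain a where a: "length a = n" "depth a = R"
    using height by (auto simp: has_height_def)
  interpret rooted_tree "{v. length v = n}" r parent depth by fact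
  interpret D: rooted_tree "{v. length v = Suc n}" "False # r" "double_parent r parent"
    "double_depth depth"
    by (rule rooted_tree_double[OF tree])
  show ?thesis
  proof (rule D.tree_diameter_central_edge[where c = "True # r" and S = "Cons True ` {v. length v = n}"
        and a = "True # a" and b = "False # a"])
    fix v assume "v \<in> {v. length v = Suc n}" "v \<noteq> False # r" "v \<noteq> True # r"
    then show "double_parent r parent v \<in> Cons True ` {v. length v = n} \<longleftrightarrow>
        v \<in> Cons True ` {v. length v = n}"
      using parent_in_V[of "tl v"] by (cases v) auto
  next
    fix v assume "v \<in> {v. length v = Suc n} - Cons True ` {v. length v = n}"
    then show "double_depth depth v \<le> R"
      using le[of "tl v"] by (cases v) auto
  qed (use root_in_V le a in auto)
qed

text \<open>
  Inside either copy nothing changes, and the joining edges of different trees differ because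
  the roots do.
\<close>
lemma independent_rooted_trees_double:
  fixes root :: "'i \<Rightarrow> bool list"
  assumes "independent_rooted_trees (Suc n) K root parent depth inner"
  shows "independent_rooted_trees (Suc (Suc n)) K (\<lambda>i. False # root i)
    (\<lambda>i. double_parent (root i) (parent i)) (\<lambda>i. double_depth (depth i))
    (\<lambda>i. {b # v | b v. v \<in> inner i})"
proof -
  interpret independent_rooted_trees "Suc n" K root parent depth inner by fact
  have len_root: "length (root i) = Suc n" if "i \<in> K" for i
    using rooted_tree.root_in_V[OF rooted[OF that]] by simp
  have root_ne: "root i \<noteq> root j" if "i \<in> K" "j \<in> K" "i \<noteq> j" for i j
    using root_inner[OF that(1)] root_inner[OF that(2)] inner_disjoint[OF that] by auto
  show ?thesis
  proof (rule independent_rooted_trees.intro)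
    fix i assume i: "i \<in> K"
    show "rooted_tree {v. length v = Suc (Suc n)} (False # root i)
        (double_parent (root i) (parent i)) (double_depth (depth i))"
      by (rule rooted_tree_double[OF rooted[OF i]])
    show "False # root i \<in> {b # v |b v. v \<in> inner i}"
      using root_inner[OF i] by blast
    fix v :: "bool list" assume v: "length v = Suc (Suc n)" "v \<noteq> False # root i"
    then obtain b w where bw: "v = b # w" "length w = Suc n"
      by (cases v) auto
    show "(v, double_parent (root i) (parent i) v) \<in> parcs (augmented_cube (Suc (Suc n)))"
      using parent_arc[OF i, of w] v bw len_root[OF i]
      by (auto simp: Let_def pverts_augmented_cube)
    show "double_parent (root i) (parent i) v \<in> {b # v |b v. v \<in> inner i}"
      using parent_inner[OF i, of w] root_inner[OF i] v bw by auto
  next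
    fix i j assume ij: "i \<in> K" "j \<in> K" "i \<noteq> j"
    show "{b # v |b v. v \<in> inner i} \<inter> {b # v |b v. v \<in> inner j} = {}"
      using inner_disjoint[OF ij] by auto
    fix v assume v: "length v = Suc (Suc n)" "v \<noteq> False # root j"
      "double_parent (root j) (parent j) v \<noteq> False # root i"
    then obtain b w where bw: "v = b # w" "length w = Suc n"
      by (cases v) auto
    have "parent j w \<noteq> root i" if "w \<noteq> root j"
      using parent_inner[OF ij(2) bw(2) that] root_inner[OF ij(1)] inner_disjoint[OF ij] by auto
    then show "double_parent (root i) (parent i) (double_parent (root j) (parent j) v) \<noteq> v"
      using no_shared_edge[OF ij bw(2)] v bw root_ne[OF ij] by auto
  qed
qed

section \<open>Four trees in dimension five\<close>

text \<open>Adjacency in augmented cubes as a recursion on the two words, so that it can be evaluated.\<close>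
fun augmented_adj :: "bool list \<Rightarrow> bool list \<Rightarrow> bool" where
  "augmented_adj [x] [y] = (x \<noteq> y)"
| "augmented_adj (x # u) (y # v) = (if x = y then augmented_adj u v else u = v \<or> u = map Not v)"
| "augmented_adj _ _ = False"

lemma augmented_adj_imp_arc:
  "\<lbrakk>length u = Suc n; length v = Suc n; augmented_adj u v\<rbrakk> \<Longrightarrow>
     (u, v) \<in> parcs (augmented_cube (Suc n))"
proof (induction n arbitrary: u v)
  case 0
  then obtain x y where "u = [x]" "v = [y]"
    by (auto simp: length_Suc_conv)
  then show ?case
    using 0 by (cases x; cases y) auto
next
  case (Suc n)
  obtain x u' where u: "u = x # u'" "length u' = Suc n"
    using Suc.prems(1) by (auto simp: length_Suc_conv)
  obtain y v' where v: "v = y # v'" "length v' = Suc n"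
    using Suc.prems(2) by (auto simp: length_Suc_conv)
  have "augmented_adj u v \<longleftrightarrow> (if x = y then augmented_adj u' v' else u' = v' \<or> u' = map Not v')"
    using u v by (cases u'; cases v') auto
  then show ?case
    using Suc.prems(3) Suc.IH[OF u(2) v(2)] u v
    by (auto simp: Let_def pverts_augmented_cube split: if_splits)
qed

definition words :: "nat \<Rightarrow> bool list list" where
  "words n = List.n_lists n [False, True]"

lemma set_words: "set (words n) = {v. length v = n}"
  by (auto simp: words_def set_n_lists)

fun xor_word :: "bool list \<Rightarrow> bool list \<Rightarrow> bool list" where
  "xor_word (x # u) (y # v) = (x \<noteq> y) # xor_word u v"
| "xor_word _ _ = []"

abbreviation (input) zero_bit :: bool (\<open>\<zero>\<close>) where "\<zero> \<equiv> False"
abbreviation (input) one_bit :: bool (\<open>\<one>\<close>) where "\<one> \<equiv> True"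

text \<open>
  The interior vertices of the base tree form a double star: its centres \<open>00000\<close> and
  \<open>01000\<close> are adjacent, the former also to \<open>00001\<close>, \<open>00010\<close>, \<open>11111\<close>, and the latter also to
  the words that result from these by flipping the second bit.
\<close>
definition core :: "bool list list" where
  "core =
    [[\<zero>, \<zero>, \<zero>, \<zero>, \<zero>], [\<zero>, \<zero>, \<zero>, \<zero>, \<one>], [\<zero>, \<zero>, \<zero>, \<one>, \<zero>], [\<one>, \<one>, \<one>, \<one>, \<one>],
     [\<zero>, \<one>, \<zero>, \<zero>, \<zero>], [\<zero>, \<one>, \<zero>, \<zero>, \<one>], [\<zero>, \<one>, \<zero>, \<one>, \<zero>], [\<one>, \<zero>, \<one>, \<one>, \<one>]]"

text \<open>
  The word to be added to a vertex to obtain its parent in the base tree rooted at \<open>00000\<close>.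
  Flipping the second bit is an automorphism of the tree that swaps the two centres, so the word
  is a function of the other four bits; its value at both centres is the edge between them.
\<close>
fun tree_mask :: "bool list \<Rightarrow> bool list" where
  "tree_mask [\<zero>, b, \<zero>, \<zero>, \<zero>] = [\<zero>, \<one>, \<zero>, \<zero>, \<zero>]"
| "tree_mask [\<zero>, b, \<zero>, \<zero>, \<one>] = [\<zero>, \<zero>, \<zero>, \<zero>, \<one>]"
| "tree_mask [\<zero>, b, \<zero>, \<one>, \<zero>] = [\<zero>, \<zero>, \<zero>, \<one>, \<zero>]"
| "tree_mask [\<zero>, b, \<zero>, \<one>, \<one>] = [\<zero>, \<zero>, \<zero>, \<zero>, \<one>]"
| "tree_mask [\<zero>, b, \<one>, \<zero>, \<zero>] = [\<zero>, \<zero>, \<one>, \<zero>, \<zero>]"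
| "tree_mask [\<zero>, b, \<one>, \<zero>, \<one>] = [\<zero>, \<zero>, \<one>, \<one>, \<one>]"
| "tree_mask [\<zero>, b, \<one>, \<one>, \<zero>] = [\<zero>, \<one>, \<one>, \<one>, \<one>]"
| "tree_mask [\<zero>, b, \<one>, \<one>, \<one>] = [\<zero>, \<one>, \<one>, \<one>, \<one>]"
| "tree_mask [\<one>, b, \<zero>, \<zero>, \<zero>] = [\<zero>, \<zero>, \<one>, \<one>, \<one>]"
| "tree_mask [\<one>, b, \<zero>, \<zero>, \<one>] = [\<one>, \<zero>, \<zero>, \<zero>, \<zero>]"
| "tree_mask [\<one>, b, \<zero>, \<one>, \<zero>] = [\<one>, \<zero>, \<zero>, \<zero>, \<zero>]"
| "tree_mask [\<one>, b, \<zero>, \<one>, \<one>] = [\<zero>, \<zero>, \<one>, \<zero>, \<zero>]"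
| "tree_mask [\<one>, b, \<one>, \<zero>, \<zero>] = [\<zero>, \<zero>, \<zero>, \<one>, \<one>]"
| "tree_mask [\<one>, b, \<one>, \<zero>, \<one>] = [\<zero>, \<zero>, \<zero>, \<one>, \<zero>]"
| "tree_mask [\<one>, b, \<one>, \<one>, \<zero>] = [\<one>, \<one>, \<one>, \<one>, \<one>]"
| "tree_mask [\<one>, b, \<one>, \<one>, \<one>] = [\<one>, \<one>, \<one>, \<one>, \<one>]"
| "tree_mask _ = []"

text \<open>
  The words listed here form a subgroup.  The four translates of \<^const>\<open>core\<close> by them
  partition the words of length 5.
\<close>
definition base_shift :: "nat \<Rightarrow> bool list" where
  "base_shift i =
    [[\<zero>, \<zero>, \<zero>, \<zero>, \<zero>], [\<one>, \<zero>, \<zero>, \<zero>, \<one>], [\<one>, \<one>, \<one>, \<zero>, \<zero>], [\<zero>, \<one>, \<one>, \<zero>, \<one>]] ! i"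

definition base_root :: "nat \<Rightarrow> bool list" where
  "base_root i =
    xor_word (base_shift i) (if i < 2 then [\<zero>, \<zero>, \<zero>, \<zero>, \<one>] else [\<zero>, \<zero>, \<zero>, \<zero>, \<zero>])"

text \<open>
  For \<open>i < 2\<close> the root is moved from the centre \<open>00000\<close> to its neighbour \<open>00001\<close>, which reverses the
  edge between these two and leaves all other parents as they are.
\<close>
definition base_parent :: "nat \<Rightarrow> bool list \<Rightarrow> bool list" where
  "base_parent i v =
     (if i < 2 \<and> v = base_shift i then base_root i
      else xor_word v (tree_mask (xor_word (base_shift i) v)))"

fun steps_to :: "('a \<Rightarrow> 'a) \<Rightarrow> 'a \<Rightarrow> nat \<Rightarrow> 'a \<Rightarrow> nat" where
  "steps_to f r 0 v = 0"
| "steps_to f r (Suc k) v = (if v = r then 0 else Suc (steps_to f r k (f v)))"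

text \<open>
  The bound 5 on the number of steps exceeds the height of all four trees, so it never
  truncates the count.
\<close>
definition base_depth :: "nat \<Rightarrow> bool list \<Rightarrow> nat" where
  "base_depth i = steps_to (base_parent i) (base_root i) 5"

definition base_inner :: "nat \<Rightarrow> bool list set" where
  "base_inner i = {v. length v = 5 \<and> xor_word (base_shift i) v \<in> set core}"

text \<open>
  What has to be known about these four trees is a finite check over the 32 words.
\<close>
lemma base_root_facts:
  "\<forall>i \<in> set [0..<4]. length (base_root i) = 5 \<and> base_depth i (base_root i) = 0 \<and>
     xor_word (base_shift i) (base_root i) \<in> set core"
  by code_simp

lemma base_parent_facts:
  "\<forall>i \<in> set [0..<4]. \<forall>v \<in> set (words 5). v \<noteq> base_root i \<longrightarrow>
     length (base_parent i v) = 5 \<and> augmented_adj v (base_parent i v) \<and>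
     xor_word (base_shift i) (base_parent i v) \<in> set core"
  by code_simp

lemma base_depth_facts:
  "\<forall>i \<in> set [0..<4]. \<forall>v \<in> set (words 5). v \<noteq> base_root i \<longrightarrow>
     base_depth i v = Suc (base_depth i (base_parent i v))"
  by code_simp

lemma base_height_facts:
  "\<forall>i \<in> set [0..<4].
     (\<forall>v \<in> set (words 5). base_depth i v \<le> (if i < 2 then 4 else 3)) \<and>
     (\<exists>v \<in> set (words 5). base_depth i v = (if i < 2 then 4 else 3))"
  by code_simp

lemma base_core_translates_disjoint:
  "\<forall>i \<in> set [0..<4]. \<forall>j \<in> set [0..<4]. i \<noteq> j \<longrightarrow>
     (\<forall>v \<in> set (words 5). xor_word (base_shift i) v \<in> set core \<longrightarrow>
        xor_word (base_shift j) v \<notin> set core)"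
  by code_simp

lemma base_no_shared_edge:
  "\<forall>i \<in> set [0..<4]. \<forall>j \<in> set [0..<4]. i \<noteq> j \<longrightarrow>
     (\<forall>v \<in> set (words 5). v \<noteq> base_root j \<longrightarrow> base_parent j v \<noteq> base_root i \<longrightarrow>
        base_parent i (base_parent j v) \<noteq> v)"
  by code_simp

lemma independent_rooted_trees_base:
  "independent_rooted_trees 5 {..<4} base_root base_parent base_depth base_inner"
proof (rule independent_rooted_trees.intro)
  fix i :: nat assume "i \<in> {..<4}"
  then have i: "i \<in> set [0..<4]"
    by auto
  show "rooted_tree {v. length v = 5} (base_root i) (base_parent i) (base_depth i)"
  proof
    show "finite {v :: bool list. length v = 5}"
      using finite_lists_length_eq[of "UNIV :: bool set" 5] by simp
    show "base_root i \<in> {v. length v = 5}" "base_depth i (base_root i) = 0"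
      using bspec[OF base_root_facts i] by simp_all
    fix v assume "v \<in> {v. length v = 5}" "v \<noteq> base_root i"
    then show "base_parent i v \<in> {v. length v = 5}"
      "base_depth i v = Suc (base_depth i (base_parent i v))"
      using bspec[OF base_parent_facts i] bspec[OF base_depth_facts i]
      unfolding set_words by simp_all
  qed
  show "base_root i \<in> base_inner i"
    using bspec[OF base_root_facts i] by (simp add: base_inner_def)
  fix v assume v: "length v = 5" "v \<noteq> base_root i"
  then have parent: "length (base_parent i v) = 5" "augmented_adj v (base_parent i v)"
      "xor_word (base_shift i) (base_parent i v) \<in> set core"
    using bspec[OF base_parent_facts i] unfolding set_words by simp_all
  then show "base_parent i v \<in> base_inner i"
    by (simp add: base_inner_def)
  have "(v, base_parent i v) \<in> parcs (augmented_cube (Suc 4))"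
    by (rule augmented_adj_imp_arc) (use v parent in simp_all)
  then show "(v, base_parent i v) \<in> parcs (augmented_cube 5)"
    by simp
next
  fix i j :: nat assume "i \<in> {..<4}" "j \<in> {..<4}" and ne: "i \<noteq> j"
  then have i: "i \<in> set [0..<4]" and j: "j \<in> set [0..<4]"
    by auto
  show "base_inner i \<inter> base_inner j = {}"
    using bspec[OF bspec[OF base_core_translates_disjoint i] j] ne
    unfolding set_words base_inner_def by blast
  show "base_parent i (base_parent j v) \<noteq> v"
    if "length v = 5" "v \<noteq> base_root j" "base_parent j v \<noteq> base_root i" for v
    using bspec[OF bspec[OF base_no_shared_edge i] j] ne that
    unfolding set_words by blast
qed

lemma base_height:
  assumes "i < 4"
  shows "has_height 5 (base_depth i) (if i < 2 then 5 - 1 else 5 - 2)"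
proof -
  have i: "i \<in> set [0..<4]"
    using assms by simp
  show ?thesis
    using bspec[OF base_height_facts i] by (cases "i < 2") (auto simp: set_words has_height_def)
qed

section \<open>Four completely independent spanning trees\<close>

text \<open>Each doubling raises the dimension and all heights by 1, starting from dimension 5.\<close>
lemma four_independent_rooted_trees:
  assumes "5 \<le> n"
  shows "\<exists>root parent depth inner.
    independent_rooted_trees n {..<4 :: nat} root parent depth inner \<and>
    (\<forall>i < 4. has_height n (depth i) (if i < 2 then n - 1 else n - 2))"
  using assms
proof (induction n rule: nat_induct_at_least)
  case base
  have "\<forall>i < 4. has_height 5 (base_depth i) (if i < 2 then 5 - 1 else 5 - 2)"
    by (intro allI impI base_height)
  then show ?case
    using independent_rooted_trees_base by blast
next
  case (Suc n)
  then obtain r :: "nat \<Rightarrow> bool list" and parent depth inner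
    where trees: "independent_rooted_trees n {..<4} r parent depth inner"
      and height: "\<forall>i < 4. has_height n (depth i) (if i < 2 then n - 1 else n - 2)"
    by blast
  obtain m where n: "n = Suc m" "4 \<le> m"
    using Suc.hyps by (cases n) auto
  have "\<forall>i < 4. has_height (Suc n) (double_depth (depth i)) (if i < 2 then Suc n - 1 else Suc n - 2)"
  proof (intro allI impI)
    fix i :: nat assume "i < 4"
    then have "has_height (Suc n) (double_depth (depth i)) (Suc (if i < 2 then n - 1 else n - 2))"
      using height has_height_double by blast
    moreover have "Suc (if i < 2 then n - 1 else n - 2) = (if i < 2 then Suc n - 1 else Suc n - 2)"
      using n by simp
    ultimately show "has_height (Suc n) (double_depth (depth i)) (if i < 2 then Suc n - 1 else Suc n - 2)"
      by simp
  qed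
  then show ?case
    using independent_rooted_trees_double[OF trees[unfolded n(1)]] unfolding n(1) by blast
qed

theorem theorem3p4:
  fixes n :: nat
  assumes "n \<ge> 6"
  shows "\<exists>T1 T2 T3 T4.
    completely_independent_spanning_trees (augmented_cube n) [T1, T2, T3, T4] \<and>
    tree_diameter T1 = 2 * n - 3 \<and> tree_diameter T2 = 2 * n - 3 \<and>
    tree_diameter T3 = 2 * n - 5 \<and> tree_diameter T4 = 2 * n - 5"
proof -
  \<comment> \<open>The last doubling is split off because it turns the heights into diameters.\<close>
  obtain k where n: "n = Suc (Suc k)" "4 \<le> k"
    using assms by (cases n; cases "n - 1") auto
  obtain r :: "nat \<Rightarrow> bool list" and parent depth inner
    where trees: "independent_rooted_trees (Suc k) {..<4} r parent depth inner"
      and height: "\<forall>i < 4. has_height (Suc k) (depth i) (if i < 2 then Suc k - 1 else Suc k - 2)"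
    using four_independent_rooted_trees[of "Suc k"] n by auto
  interpret small: independent_rooted_trees "Suc k" "{..<4}" r parent depth inner
    by (rule trees)
  interpret double: independent_rooted_trees "Suc (Suc k)" "{..<4}" "\<lambda>i. False # r i"
    "\<lambda>i. double_parent (r i) (parent i)" "\<lambda>i. double_depth (depth i)"
    "\<lambda>i. {b # v | b v. v \<in> inner i}"
    by (rule independent_rooted_trees_double[OF trees])
  have diameter: "tree_diameter (double.tree i) = 2 * (if i < 2 then Suc k - 1 else Suc k - 2) + 1"
    if "i < 4" for i
    by (rule tree_diameter_double[OF small.rooted]) (use that height in auto)
  have "completely_independent_spanning_trees (augmented_cube n) (map double.tree [0, 1, 2, 3])"
    unfolding n(1) by (rule double.trees_completely_independent) auto
  moreover have "tree_diameter (double.tree 0) = 2 * n - 3" "tree_diameter (double.tree 1) = 2 * n - 3"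
    "tree_diameter (double.tree 2) = 2 * n - 5" "tree_diameter (double.tree 3) = 2 * n - 5"
    using diameter[of 0] diameter[of 1] diameter[of 2] diameter[of 3] n by simp_all
  ultimately show ?thesis
    unfolding list.map by blast
qed

end
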